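(* The optimization problem $$\max_{\boldsymbol\alpha}\ \min_{i\neq i^*}\mathcal V_i(\alpha_i,\alpha_{i^*})\quad\text{s.t. }\sum_{i=1}^k\alpha_i=1,\ \alpha_i\ge0,\ i=1,\dots,k,$$ has a unique optimal solution $\boldsymbol\alpha^*$, and it satisfies $$\alpha^*_{i^*}=\max\left\{\bar\alpha_{i^*}\in(0,1):\ \sum_{i\ne i^*}\frac{\mathcal U_i^{*,\min}\left(r_i^f(\bar\alpha_{i^*})\right)}{\mathcal U_i^{\min}\left(r_i^f(\bar\alpha_{i^*})\right)}\ge1\right\},$$ $$\mathcal V_i(\alpha_i^*,\alpha_{i^*}^* )=\mathcal V_j(\alpha_j^*,\alpha_{i^*}^* )\qquad\text{for all } i,j\ne i^*.$$
   Context: Let $k\ge2$, $\mu_1,\dots,\mu_k\in\mathbb R$, $\sigma_1^2,\dots,\sigma_k^2>0$, and assume $i^*=\arg\max_i\mu_i$ is unique. For $i\ne i^*$ and $\alpha_i,\alpha_{i^*}\ge0$ define $$\mathcal V_i(\alpha_i,\alpha_{i^*})=\min_{\phi\in\mathbb R}\left(\tfrac{\alpha_i}{2}\log\left(1+\tfrac{(\mu_i-\phi)^2}{\sigma_i^2}\right)+\tfrac{\alpha_{i^*}}{2}\log\left(1+\tfrac{(\mu_{i^*}-\phi)^2}{\sigma_{i^*}^2}\right)\right).$$ For $r\ge0$ let $$g_i(\phi,r)=r\log\left(1+\tfrac{(\mu_i-\phi)^2}{\sigma_i^2}\right)+\log\left(1+\tfrac{(\mu_{i^*}-\phi)^2}{\sigma_{i^*}^2}\right),$$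 and let $\phi_i^{\min}(r)$ be the smallest element of $\arg\min_{\phi\in\mathbb R}g_i(\phi,r)$. Define $$\mathcal U_i^{\min}(r)=\log\left(1+\tfrac{(\mu_i-\phi_i^{\min}(r))^2}{\sigma_i^2}\right),\qquad \mathcal U_i^{*,\min}(r)=\log\left(1+\tfrac{(\mu_{i^*}-\phi_i^{\min}(r))^2}{\sigma_{i^*}^2}\right).$$ For each $\bar\alpha_{i^*}\in(0,1)$, $\boldsymbol\alpha^f(\bar\alpha_{i^*})$ denotes the unique vector with $\alpha_i^f(\bar\alpha_{i^*})>0$ for all $i$, $\sum_i\alpha_i^f(\bar\alpha_{i^*})=1$, $\alpha_{i^*}^f(\bar\alpha_{i^*})=\bar\alpha_{i^*}$ and $\mathcal V_i(\alpha_i^f(\bar\alpha_{i^*}),\bar\alpha_{i^*})=\mathcal V_{i'}(\alpha_{i'}^f(\bar\alpha_{i^*}),\bar\alpha_{i^*})$ for all $i,i'\ne i^*$ (such a vector exists and is unique). Set $r_i^f(\bar\alpha_{i^*})=\alpha_i^f(\bar\alpha_{i^*})/\bar\alpha_{i^*}$ for $i\ne i^*$. *)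

theory Defs
  imports "HOL-Analysis.Analysis"
begin

(* The k alternatives are the elements of a finite type 'k; the means, the standard deviations
   and the allocations are vectors in real ^ 'k, and s is the index of the best alternative. *)

definition log_dev :: "real ^ 'k \<Rightarrow> real ^ 'k \<Rightarrow> 'k \<Rightarrow> real \<Rightarrow> real" where
  "log_dev \<mu> \<sigma> i \<phi> = ln (1 + (\<mu> $ i - \<phi>)\<^sup>2 / (\<sigma> $ i)\<^sup>2)"

(* LEAST over the range of values is the minimum; see rate_fun_attained. *)
definition rate_fun :: "real ^ 'k \<Rightarrow> real ^ 'k \<Rightarrow> 'k \<Rightarrow> 'k \<Rightarrow> real \<Rightarrow> real \<Rightarrow> real" where
  "rate_fun \<mu> \<sigma> s i a b =
     (LEAST v. \<exists>\<phi>. v = a / 2 * log_dev \<mu> \<sigma> i \<phi> + b / 2 * log_dev \<mu> \<sigma> s \<phi>)"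

definition g_fun :: "real ^ 'k \<Rightarrow> real ^ 'k \<Rightarrow> 'k \<Rightarrow> 'k \<Rightarrow> real \<Rightarrow> real \<Rightarrow> real" where
  "g_fun \<mu> \<sigma> s i \<phi> r = r * log_dev \<mu> \<sigma> i \<phi> + log_dev \<mu> \<sigma> s \<phi>"

(* The argmin need not be a singleton, but it has a smallest element; see phi_min_least. *)
definition phi_min :: "real ^ 'k \<Rightarrow> real ^ 'k \<Rightarrow> 'k \<Rightarrow> 'k \<Rightarrow> real \<Rightarrow> real" where
  "phi_min \<mu> \<sigma> s i r = (LEAST \<phi>. is_arg_min (\<lambda>\<psi>. g_fun \<mu> \<sigma> s i \<psi> r) (\<lambda>_. True) \<phi>)"

definition U_min :: "real ^ 'k \<Rightarrow> real ^ 'k \<Rightarrow> 'k \<Rightarrow> 'k \<Rightarrow> real \<Rightarrow> real" where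
  "U_min \<mu> \<sigma> s i r = log_dev \<mu> \<sigma> i (phi_min \<mu> \<sigma> s i r)"

definition U_star_min :: "real ^ 'k \<Rightarrow> real ^ 'k \<Rightarrow> 'k \<Rightarrow> 'k \<Rightarrow> real \<Rightarrow> real" where
  "U_star_min \<mu> \<sigma> s i r = log_dev \<mu> \<sigma> s (phi_min \<mu> \<sigma> s i r)"

(* Meaningful for 0 < b < 1, where the vector described exists and is unique. *)
definition alpha_f :: "real ^ 'k \<Rightarrow> real ^ 'k \<Rightarrow> 'k \<Rightarrow> real \<Rightarrow> real ^ ('k::finite)" where
  "alpha_f \<mu> \<sigma> s b = (THE \<alpha>. (\<forall>i. \<alpha> $ i > 0) \<and> (\<Sum>i\<in>UNIV. \<alpha> $ i) = 1 \<and> \<alpha> $ s = b \<and>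
     (\<forall>i j. i \<noteq> s \<longrightarrow> j \<noteq> s \<longrightarrow> rate_fun \<mu> \<sigma> s i (\<alpha> $ i) b = rate_fun \<mu> \<sigma> s j (\<alpha> $ j) b))"

definition r_f :: "real ^ 'k \<Rightarrow> real ^ 'k \<Rightarrow> ('k::finite) \<Rightarrow> 'k \<Rightarrow> real \<Rightarrow> real" where
  "r_f \<mu> \<sigma> s i b = alpha_f \<mu> \<sigma> s b $ i / b"

definition feasible :: "real ^ ('k::finite) \<Rightarrow> bool" where
  "feasible \<alpha> \<longleftrightarrow> (\<Sum>i\<in>UNIV. \<alpha> $ i) = 1 \<and> (\<forall>i. \<alpha> $ i \<ge> 0)"

definition optimal :: "real ^ 'k \<Rightarrow> real ^ 'k \<Rightarrow> 'k \<Rightarrow> real ^ ('k::finite) \<Rightarrow> bool" where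
  "optimal \<mu> \<sigma> s = is_arg_max (\<lambda>\<alpha>. MIN i\<in>{i. i \<noteq> s}. rate_fun \<mu> \<sigma> s i (\<alpha> $ i) (\<alpha> $ s)) feasible"

lemma log_dev_mono:
  assumes "\<bar>\<mu> $ i - \<phi>\<bar> \<le> \<bar>\<mu> $ i - \<psi>\<bar>"
  shows "log_dev \<mu> \<sigma> i \<phi> \<le> log_dev \<mu> \<sigma> i \<psi>"
proof -
  have "(\<mu> $ i - \<phi>)\<^sup>2 / (\<sigma> $ i)\<^sup>2 \<le> (\<mu> $ i - \<psi>)\<^sup>2 / (\<sigma> $ i)\<^sup>2"
    using assms by (intro divide_right_mono) (auto simp: abs_le_square_iff)
  moreover have "0 \<le> (\<mu> $ i - \<phi>)\<^sup>2 / (\<sigma> $ i)\<^sup>2" by simp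
  ultimately show ?thesis
    unfolding log_dev_def by (subst ln_le_cancel_iff) linarith+
qed

lemma continuous_on_log_dev: "continuous_on S (log_dev \<mu> \<sigma> i)"
proof (cases "\<sigma> $ i = 0")
  case True
  then have "log_dev \<mu> \<sigma> i = (\<lambda>_. 0)"
    by (auto simp: log_dev_def fun_eq_iff)
  then show ?thesis
    by simp
next
  case False
  have "1 + (\<mu> $ i - x)\<^sup>2 / (\<sigma> $ i)\<^sup>2 \<noteq> 0" for x
    using zero_le_divide_iff[of "(\<mu> $ i - x)\<^sup>2" "(\<sigma> $ i)\<^sup>2"]
    by (smt (verit) zero_le_power2)
  then show ?thesis
    unfolding log_dev_def[abs_def] using False
    by (intro continuous_intros) auto
qed

lemma weighted_log_dev_least_arg_min:
  fixes \<mu> \<sigma> :: "real ^ 'k"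
  assumes "(\<sigma> $ i)\<^sup>2 > 0" "(\<sigma> $ j)\<^sup>2 > 0" "a \<ge> 0" "b > 0"
  defines "f \<equiv> \<lambda>\<phi>. a * log_dev \<mu> \<sigma> i \<phi> + b * log_dev \<mu> \<sigma> j \<phi>"
  obtains \<phi> where "is_arg_min f (\<lambda>_. True) \<phi>" "\<And>\<psi>. is_arg_min f (\<lambda>_. True) \<psi> \<Longrightarrow> \<phi> \<le> \<psi>"
proof -
  define l u where "l = min (\<mu> $ i) (\<mu> $ j)" and "u = max (\<mu> $ i) (\<mu> $ j)"
  define c where "c = (\<lambda>\<psi>. max l (min u \<psi>))"
  have cont: "continuous_on S f" for S
    unfolding f_def by (intro continuous_intros continuous_on_log_dev)
  have c_in: "c \<psi> \<in> {l..u}" for \<psi>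
    by (auto simp: c_def l_def u_def)
  have f_c: "f (c \<psi>) \<le> f \<psi>" for \<psi>
    unfolding f_def using assms(3,4)
    by (intro add_mono mult_left_mono log_dev_mono) (auto simp: c_def l_def u_def)
  have "\<exists>x\<in>{l..u}. \<forall>y\<in>{l..u}. f x \<le> f y"
    by (intro continuous_attains_inf cont) (auto simp: l_def u_def)
  then obtain m where m: "m \<in> {l..u}" "\<And>y. y \<in> {l..u} \<Longrightarrow> f m \<le> f y"
    by blast
  have m_min: "f m \<le> f y" for y
    using m(2)[OF c_in[of y]] f_c[of y] by linarith
  have arg_min_iff: "is_arg_min f (\<lambda>_. True) \<psi> \<longleftrightarrow> f \<psi> = f m" for \<psi>
    using m_min by (auto simp: is_arg_min_def not_less intro: antisym)
  define A where "A = {\<psi> \<in> {l..u}. f \<psi> = f m}"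
  have "closed A"
    unfolding A_def
    by (rule continuous_closed_preimage_constant[OF cont]) simp
  moreover have "bounded A"
    by (rule bounded_subset[of "{l..u}"]) (auto simp: A_def)
  ultimately have "compact A"
    by (simp add: compact_eq_bounded_closed)
  moreover have "A \<noteq> {}"
    using m by (auto simp: A_def)
  ultimately obtain p where p: "p \<in> A" "\<And>q. q \<in> A \<Longrightarrow> p \<le> q"
    using compact_attains_inf by metis
  show thesis
  proof
    show "is_arg_min f (\<lambda>_. True) p"
      using p(1) by (simp add: arg_min_iff A_def)
  next
    fix \<psi>
    assume "is_arg_min f (\<lambda>_. True) \<psi>"
    then have eq: "f \<psi> = f m"
      by (simp add: arg_min_iff)
    show "p \<le> \<psi>"
    proof (cases "\<psi> < l")
      case True
      have strict: "log_dev \<mu> \<sigma> j l < log_dev \<mu> \<sigma> j \<psi>"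
      proof -
        have "\<bar>\<mu> $ j - l\<bar> < \<bar>\<mu> $ j - \<psi>\<bar>"
          using True by (auto simp: l_def)
        then have "(\<mu> $ j - l)\<^sup>2 < (\<mu> $ j - \<psi>)\<^sup>2"
          by (metis abs_le_square_iff not_less)
        then have "(\<mu> $ j - l)\<^sup>2 / (\<sigma> $ j)\<^sup>2 < (\<mu> $ j - \<psi>)\<^sup>2 / (\<sigma> $ j)\<^sup>2"
          using assms(2) by (rule divide_strict_right_mono)
        moreover have "0 \<le> (\<mu> $ j - l)\<^sup>2 / (\<sigma> $ j)\<^sup>2"
          by simp
        ultimately show ?thesis
          unfolding log_dev_def by (subst ln_less_cancel_iff) linarith+
      qed
      have "a * log_dev \<mu> \<sigma> i l \<le> a * log_dev \<mu> \<sigma> i \<psi>"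
        using True assms(3) by (intro mult_left_mono log_dev_mono) (auto simp: l_def)
      moreover have "b * log_dev \<mu> \<sigma> j l < b * log_dev \<mu> \<sigma> j \<psi>"
        using strict assms(4) by simp
      ultimately have "f l < f \<psi>"
        by (simp add: f_def)
      then show ?thesis
        using m_min[of l] eq by linarith
    next
      case False
      show ?thesis
      proof (cases "\<psi> \<le> u")
        case True
        then show ?thesis
          using False eq by (intro p(2)) (auto simp: A_def)
      next
        case False
        then show ?thesis
          using p(1) by (auto simp: A_def)
      qed
    qed
  qed
qed

lemma rate_fun_attained:
  assumes "(\<sigma> $ i)\<^sup>2 > 0" "(\<sigma> $ s)\<^sup>2 > 0" "a \<ge> 0" "b \<ge> 0"
  shows "\<exists>\<phi>. rate_fun \<mu> \<sigma> s i a b = a / 2 * log_dev \<mu> \<sigma> i \<phi> + b / 2 * log_dev \<mu> \<sigma> s \<phi>"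
    and "rate_fun \<mu> \<sigma> s i a b \<le> a / 2 * log_dev \<mu> \<sigma> i \<phi> + b / 2 * log_dev \<mu> \<sigma> s \<phi>"
proof -
  define f where "f = (\<lambda>\<phi>. a / 2 * log_dev \<mu> \<sigma> i \<phi> + b / 2 * log_dev \<mu> \<sigma> s \<phi>)"
  have "\<exists>p. \<forall>q. f p \<le> f q"
  proof (cases "b = 0")
    case True
    have "f (\<mu> $ i) \<le> f q" for q
      unfolding f_def using True assms(3) by (simp add: mult_left_mono log_dev_mono)
    then show ?thesis
      by blast
  next
    case False
    then have "b / 2 > 0"
      using assms(4) by simp
    then obtain p where "is_arg_min f (\<lambda>_. True) p"
      unfolding f_def using weighted_log_dev_least_arg_min[of \<sigma> i s "a / 2" "b / 2" \<mu>] assms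
      by auto
    then show ?thesis
      by (auto simp: is_arg_min_def not_less)
  qed
  then obtain p where p: "\<And>q. f p \<le> f q"
    by blast
  then have eq: "rate_fun \<mu> \<sigma> s i a b = f p"
    unfolding rate_fun_def f_def by (intro Least_equality) auto
  show "\<exists>\<phi>. rate_fun \<mu> \<sigma> s i a b = a / 2 * log_dev \<mu> \<sigma> i \<phi> + b / 2 * log_dev \<mu> \<sigma> s \<phi>"
    using eq by (auto simp: f_def)
  show "rate_fun \<mu> \<sigma> s i a b \<le> a / 2 * log_dev \<mu> \<sigma> i \<phi> + b / 2 * log_dev \<mu> \<sigma> s \<phi>"
    using p[of \<phi>] eq by (simp add: f_def)
qed

lemma phi_min_least:
  assumes "(\<sigma> $ i)\<^sup>2 > 0" "(\<sigma> $ s)\<^sup>2 > 0" "r \<ge> 0"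
  shows "is_arg_min (\<lambda>\<psi>. g_fun \<mu> \<sigma> s i \<psi> r) (\<lambda>_. True) (phi_min \<mu> \<sigma> s i r)"
    and "is_arg_min (\<lambda>\<psi>. g_fun \<mu> \<sigma> s i \<psi> r) (\<lambda>_. True) \<phi> \<Longrightarrow> phi_min \<mu> \<sigma> s i r \<le> \<phi>"
proof -
  obtain p where p: "is_arg_min (\<lambda>\<psi>. g_fun \<mu> \<sigma> s i \<psi> r) (\<lambda>_. True) p"
      "\<And>q. is_arg_min (\<lambda>\<psi>. g_fun \<mu> \<sigma> s i \<psi> r) (\<lambda>_. True) q \<Longrightarrow> p \<le> q"
    using weighted_log_dev_least_arg_min[of \<sigma> i s r 1 \<mu>] assms
    by (auto simp: g_fun_def)
  then have "phi_min \<mu> \<sigma> s i r = p"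
    unfolding phi_min_def by (intro Least_equality)
  with p show "is_arg_min (\<lambda>\<psi>. g_fun \<mu> \<sigma> s i \<psi> r) (\<lambda>_. True) (phi_min \<mu> \<sigma> s i r)"
    and "is_arg_min (\<lambda>\<psi>. g_fun \<mu> \<sigma> s i \<psi> r) (\<lambda>_. True) \<phi> \<Longrightarrow> phi_min \<mu> \<sigma> s i r \<le> \<phi>"
    by auto
qed

end

theory Submission
  imports Defs
begin

text \<open>
  Each rate is an infimum of linear functions, hence concave and positively homogeneous.
  Stationarity shows that a minimiser lies strictly between the two means and determines
  the ratio of the weights, so the rates are strictly concave across rays. This gives uniqueness
  of the optimum, and an exchange argument equalises the rates at the maximum over a slice
  with prescribed weight \<open>b\<close> of the best alternative. Adding up supergradient inequalities, the
  sum of the ratios at \<open>b\<close>, minus 1, has the sign of the slope of the slice maximum towards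
  the optimum: the sum exceeds 1 to the left and is below 1 to the right of the optimal weight.
  The smallest minimiser is right continuous in the ratio of the weights, and these
  ratios decrease in \<open>b\<close>, so the sum is left continuous in \<open>b\<close> and is still at least 1 at the
  optimal weight itself.
\<close>

section \<open>Deviations: strict monotonicity, positivity and derivative\<close>

lemma log_dev_strict_mono:
  assumes "(\<sigma> $ i)\<^sup>2 > 0" "\<bar>\<mu> $ i - \<phi>\<bar> < \<bar>\<mu> $ i - \<psi>\<bar>"
  shows "log_dev \<mu> \<sigma> i \<phi> < log_dev \<mu> \<sigma> i \<psi>"
proof -
  have "(\<mu> $ i - \<phi>)\<^sup>2 < (\<mu> $ i - \<psi>)\<^sup>2"
    using assms(2) by (metis abs_le_square_iff not_less)
  then have "(\<mu> $ i - \<phi>)\<^sup>2 / (\<sigma> $ i)\<^sup>2 < (\<mu> $ i - \<psi>)\<^sup>2 / (\<sigma> $ i)\<^sup>2"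
    using assms(1) by (rule divide_strict_right_mono)
  moreover have "0 \<le> (\<mu> $ i - \<phi>)\<^sup>2 / (\<sigma> $ i)\<^sup>2"
    by simp
  ultimately show ?thesis
    unfolding log_dev_def by (subst ln_less_cancel_iff) linarith+
qed

lemma log_dev_at_mean [simp]: "log_dev \<mu> \<sigma> i (\<mu> $ i) = 0"
  by (simp add: log_dev_def)

lemma log_dev_nonneg: "0 \<le> log_dev \<mu> \<sigma> i \<phi>"
  using log_dev_mono[of \<mu> i "\<mu> $ i" \<phi> \<sigma>] by simp

lemma log_dev_pos:
  assumes "(\<sigma> $ i)\<^sup>2 > 0" "\<phi> \<noteq> \<mu> $ i"
  shows "0 < log_dev \<mu> \<sigma> i \<phi>"
  using log_dev_strict_mono[of \<sigma> i \<mu> "\<mu> $ i" \<phi>] assms by simp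

lemma log_dev_has_derivative:
  assumes "(\<sigma> $ i)\<^sup>2 > 0"
  shows "(log_dev \<mu> \<sigma> i has_real_derivative
    2 * (\<phi> - \<mu> $ i) / ((\<sigma> $ i)\<^sup>2 + (\<mu> $ i - \<phi>)\<^sup>2)) (at \<phi>)"
proof -
  have pos: "0 < (\<sigma> $ i)\<^sup>2 + (\<mu> $ i - \<phi>)\<^sup>2"
    using assms by (simp add: add_pos_nonneg)
  have arg: "1 + (\<mu> $ i - \<phi>)\<^sup>2 / (\<sigma> $ i)\<^sup>2 = ((\<sigma> $ i)\<^sup>2 + (\<mu> $ i - \<phi>)\<^sup>2) / (\<sigma> $ i)\<^sup>2"
    using assms by (simp add: add_divide_distrib)
  then have arg_pos: "0 < 1 + (\<mu> $ i - \<phi>)\<^sup>2 / (\<sigma> $ i)\<^sup>2"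
    using pos assms by simp
  have "((\<lambda>\<phi>. 1 + (\<mu> $ i - \<phi>)\<^sup>2 / (\<sigma> $ i)\<^sup>2) has_real_derivative
      2 * (\<phi> - \<mu> $ i) / (\<sigma> $ i)\<^sup>2) (at \<phi>)"
    using assms by (auto intro!: derivative_eq_intros simp: field_simps)
  then have "((\<lambda>\<phi>. ln (1 + (\<mu> $ i - \<phi>)\<^sup>2 / (\<sigma> $ i)\<^sup>2)) has_real_derivative
      1 / (1 + (\<mu> $ i - \<phi>)\<^sup>2 / (\<sigma> $ i)\<^sup>2) * (2 * (\<phi> - \<mu> $ i) / (\<sigma> $ i)\<^sup>2)) (at \<phi>)"
    using DERIV_ln_divide[OF arg_pos] by (rule DERIV_chain2[rotated])
  also have "1 / (1 + (\<mu> $ i - \<phi>)\<^sup>2 / (\<sigma> $ i)\<^sup>2) * (2 * (\<phi> - \<mu> $ i) / (\<sigma> $ i)\<^sup>2)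
      = 2 * (\<phi> - \<mu> $ i) / ((\<sigma> $ i)\<^sup>2 + (\<mu> $ i - \<phi>)\<^sup>2)"
    unfolding arg using assms by simp
  finally show ?thesis
    by (simp add: log_dev_def[abs_def])
qed

lemma continuous_on_Min_image:
  fixes f :: "'i \<Rightarrow> 'a::topological_space \<Rightarrow> 'b::linorder_topology"
  assumes "finite I" "I \<noteq> {}" "\<And>i. i \<in> I \<Longrightarrow> continuous_on A (f i)"
  shows "continuous_on A (\<lambda>x. MIN i\<in>I. f i x)"
  using assms
proof (induction I rule: finite_ne_induct)
  case (singleton i)
  then show ?case by simp
next
  case (insert i I)
  then have "continuous_on A (\<lambda>x. min (f i x) (MIN i\<in>I. f i x))"
    by (intro continuous_on_min) auto
  with insert show ?case by simp
qed

section \<open>Minimisers for a given ratio of weights\<close>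

locale selection =
  fixes \<mu> \<sigma> :: "real ^ ('k::finite)" and s :: 'k
  assumes other: "\<exists>j. j \<noteq> s"
    and var_pos: "\<And>i. (\<sigma> $ i)\<^sup>2 > 0"
    and best: "\<And>i. i \<noteq> s \<Longrightarrow> \<mu> $ i < \<mu> $ s"
begin

abbreviation "h \<equiv> log_dev \<mu> \<sigma>"
abbreviation "V \<equiv> rate_fun \<mu> \<sigma> s"
abbreviation "p \<equiv> phi_min \<mu> \<sigma> s"

text \<open>For a positive weight of the best alternative, minimisers depend only on the ratio of
  the weights, so that weight is normalised to 1. The pointwise form can be instantiated directly at
  test points.\<close>

definition g_argmin :: "'k \<Rightarrow> real \<Rightarrow> real \<Rightarrow> bool" where
  "g_argmin i r \<phi> \<longleftrightarrow> (\<forall>\<psi>. r * h i \<phi> + h s \<phi> \<le> r * h i \<psi> + h s \<psi>)"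

lemma is_arg_min_g_fun_iff: "is_arg_min (\<lambda>\<psi>. g_fun \<mu> \<sigma> s i \<psi> r) (\<lambda>_. True) \<phi> \<longleftrightarrow> g_argmin i r \<phi>"
  by (auto simp: is_arg_min_def g_argmin_def g_fun_def not_less)

lemma g_argmin_phi_min: "r \<ge> 0 \<Longrightarrow> g_argmin i r (p i r)"
  using phi_min_least(1)[OF var_pos var_pos, of r \<mu> s i] by (simp add: is_arg_min_g_fun_iff)

lemma phi_min_le: "\<lbrakk>r \<ge> 0; g_argmin i r \<phi>\<rbrakk> \<Longrightarrow> p i r \<le> \<phi>"
  using phi_min_least(2)[OF var_pos var_pos, of r \<mu> s i] by (simp add: is_arg_min_g_fun_iff)

text \<open>First-order condition. The signs of its terms locate the minimiser, and being affine in
  \<open>r\<close> it also recovers the ratio from the minimiser.\<close>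

lemma g_argmin_stationary:
  assumes "g_argmin i r \<phi>"
  shows "r * (2 * (\<phi> - \<mu> $ i) / ((\<sigma> $ i)\<^sup>2 + (\<mu> $ i - \<phi>)\<^sup>2))
    + 2 * (\<phi> - \<mu> $ s) / ((\<sigma> $ s)\<^sup>2 + (\<mu> $ s - \<phi>)\<^sup>2) = 0"
\<comment> \<open>The minimum is global, so any radius serves.\<close>
proof (rule DERIV_local_min[where d = 1])
  show "((\<lambda>\<phi>. r * h i \<phi> + h s \<phi>) has_real_derivative
      r * (2 * (\<phi> - \<mu> $ i) / ((\<sigma> $ i)\<^sup>2 + (\<mu> $ i - \<phi>)\<^sup>2))
      + 2 * (\<phi> - \<mu> $ s) / ((\<sigma> $ s)\<^sup>2 + (\<mu> $ s - \<phi>)\<^sup>2)) (at \<phi>)"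
    by (intro DERIV_add DERIV_cmult log_dev_has_derivative var_pos)
qed (use assms in \<open>auto simp: g_argmin_def\<close>)

lemma denominator_pos: "0 < (\<sigma> $ i)\<^sup>2 + (\<mu> $ i - \<phi>)\<^sup>2"
  using var_pos[of i] by (simp add: add_pos_nonneg)

text \<open>At or below the mean of \<open>i\<close>, the first term of the stationarity equation is
  at most 0 and the second is negative. Strictness, also at \<open>r = 0\<close>, keeps
  \<open>h i\<close> positive at a minimiser, so that it may stand in a denominator.\<close>

lemma g_argmin_gt:
  assumes "i \<noteq> s" "r \<ge> 0" "g_argmin i r \<phi>"
  shows "\<mu> $ i < \<phi>"
proof (rule ccontr)
  assume "\<not> \<mu> $ i < \<phi>"
  then have "2 * (\<phi> - \<mu> $ i) / ((\<sigma> $ i)\<^sup>2 + (\<mu> $ i - \<phi>)\<^sup>2) \<le> 0"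
    using denominator_pos[of i \<phi>] by (intro divide_nonpos_pos) auto
  then have "r * (2 * (\<phi> - \<mu> $ i) / ((\<sigma> $ i)\<^sup>2 + (\<mu> $ i - \<phi>)\<^sup>2)) \<le> 0"
    using assms(2) by (rule mult_nonneg_nonpos[rotated])
  moreover have "2 * (\<phi> - \<mu> $ s) / ((\<sigma> $ s)\<^sup>2 + (\<mu> $ s - \<phi>)\<^sup>2) < 0"
    using \<open>\<not> \<mu> $ i < \<phi>\<close> best[OF assms(1)] denominator_pos[of s \<phi>] by (intro divide_neg_pos) auto
  ultimately show False
    using g_argmin_stationary[OF assms(3)] by linarith
qed

text \<open>The mirrored sign argument; strictness needs \<open>r > 0\<close>, because at
  \<open>r = 0\<close> the minimiser is \<open>\<mu> $ s\<close> itself.\<close>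

lemma g_argmin_less:
  assumes "i \<noteq> s" "r > 0" "g_argmin i r \<phi>"
  shows "\<phi> < \<mu> $ s"
proof (rule ccontr)
  assume "\<not> \<phi> < \<mu> $ s"
  then have "2 * (\<phi> - \<mu> $ s) / ((\<sigma> $ s)\<^sup>2 + (\<mu> $ s - \<phi>)\<^sup>2) \<ge> 0"
    using denominator_pos[of s \<phi>] by (intro divide_nonneg_pos) auto
  moreover have "2 * (\<phi> - \<mu> $ i) / ((\<sigma> $ i)\<^sup>2 + (\<mu> $ i - \<phi>)\<^sup>2) > 0"
    using \<open>\<not> \<phi> < \<mu> $ s\<close> best[OF assms(1)] denominator_pos[of i \<phi>] by (intro divide_pos_pos) auto
  then have "r * (2 * (\<phi> - \<mu> $ i) / ((\<sigma> $ i)\<^sup>2 + (\<mu> $ i - \<phi>)\<^sup>2)) > 0"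
    by (rule mult_pos_pos[OF assms(2)])
  ultimately show False
    using g_argmin_stationary[OF assms(3)] by linarith
qed

lemma g_argmin_le:
  assumes "i \<noteq> s" "r \<ge> 0" "g_argmin i r \<phi>"
  shows "\<phi> \<le> \<mu> $ s"
proof (cases "r = 0")
  case True
  then have "h s \<phi> \<le> 0"
    using assms(3) by (auto simp: g_argmin_def dest: spec[of _ "\<mu> $ s"])
  then show ?thesis
    using log_dev_pos[OF var_pos, of \<phi> \<mu> s] by fastforce
next
  case False
  then show ?thesis
    using g_argmin_less[of i r \<phi>] assms by simp
qed

text \<open>Stationarity is an affine equation for the ratio, and its coefficient is nonzero because
  the minimiser lies strictly to the right of \<open>\<mu> $ i\<close>.\<close>

lemma g_argmin_ratio_unique:
  assumes "i \<noteq> s" "r \<ge> 0" "g_argmin i r \<phi>" "g_argmin i r' \<phi>"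
  shows "r = r'"
proof -
  have "2 * (\<phi> - \<mu> $ i) / ((\<sigma> $ i)\<^sup>2 + (\<mu> $ i - \<phi>)\<^sup>2) \<noteq> 0"
    using g_argmin_gt[OF assms(1-3)] denominator_pos[of i \<phi>] by simp
  moreover have "r * (2 * (\<phi> - \<mu> $ i) / ((\<sigma> $ i)\<^sup>2 + (\<mu> $ i - \<phi>)\<^sup>2))
      = r' * (2 * (\<phi> - \<mu> $ i) / ((\<sigma> $ i)\<^sup>2 + (\<mu> $ i - \<phi>)\<^sup>2))"
    using g_argmin_stationary[OF assms(3)] g_argmin_stationary[OF assms(4)] by linarith
  ultimately show ?thesis
    by (metis mult_right_cancel)
qed

lemma h_phi_min_pos: "\<lbrakk>i \<noteq> s; r \<ge> 0\<rbrakk> \<Longrightarrow> 0 < h i (p i r)"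
  using g_argmin_gt[OF _ _ g_argmin_phi_min] by (intro log_dev_pos var_pos) (metis less_irrefl)

text \<open>Testing each minimiser against the other and adding the inequalities shows that a larger
  ratio does not increase the deviation from \<open>\<mu> $ i\<close>. To the right of that mean the
  deviation is strictly increasing, so the points are ordered in the same way.\<close>

lemma phi_min_antimono:
  assumes "i \<noteq> s" "0 \<le> r" "r \<le> r'"
  shows "p i r' \<le> p i r"
proof (cases "r = r'")
  case False
  have "r * h i (p i r) + h s (p i r) \<le> r * h i (p i r') + h s (p i r')"
    using g_argmin_phi_min[of r i] assms by (auto simp: g_argmin_def)
  moreover have "r' * h i (p i r') + h s (p i r') \<le> r' * h i (p i r) + h s (p i r)"
    using g_argmin_phi_min[of r' i] assms by (auto simp: g_argmin_def)
  ultimately have "(r' - r) * h i (p i r') \<le> (r' - r) * h i (p i r)"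
    by (simp add: algebra_simps)
  then have le: "h i (p i r') \<le> h i (p i r)"
    using False assms(3) by simp
  show ?thesis
  proof (rule ccontr)
    assume "\<not> p i r' \<le> p i r"
    moreover have "\<mu> $ i < p i r"
      using g_argmin_gt[OF assms(1,2) g_argmin_phi_min] assms(2) by simp
    ultimately have "h i (p i r) < h i (p i r')"
      by (intro log_dev_strict_mono var_pos) auto
    with le show False by simp
  qed
qed simp

(* A limit of minimisers from larger ratios is a minimiser below p i r, hence p i r itself. *)
lemma phi_min_right_continuous:
  assumes "i \<noteq> s" "r \<ge> 0"
  shows "continuous (at r within {r..}) (p i)"
  unfolding continuous_within_eps_delta
proof (intro allI impI)
  fix e :: real
  assume "e > 0"
  define f where "f \<phi> = r * h i \<phi> + h s \<phi>" for \<phi>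
  define q where "q = p i r"
  have q_min: "f q \<le> f \<phi>" for \<phi>
    using g_argmin_phi_min[OF assms(2), of i] by (simp add: g_argmin_def f_def q_def)
  \<comment> \<open>No point up to \<open>q - e\<close> is a minimiser, since \<open>q\<close> is
    the smallest one; compactness turns this into a positive gap above \<open>f q\<close> on the
    interval.\<close>
  obtain m where m: "f q < m" "\<And>\<phi>. \<phi> \<in> {\<mu> $ i..q - e} \<Longrightarrow> m \<le> f \<phi>"
  proof (cases "\<mu> $ i \<le> q - e")
    case True
    have "continuous_on {\<mu> $ i..q - e} f"
      unfolding f_def by (intro continuous_intros continuous_on_log_dev)
    then obtain x where x: "x \<in> {\<mu> $ i..q - e}" "\<And>y. y \<in> {\<mu> $ i..q - e} \<Longrightarrow> f x \<le> f y"
      using True continuous_attains_inf[of "{\<mu> $ i..q - e}" f] by auto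
    have "\<not> g_argmin i r x"
      using phi_min_le[OF assms(2), of i x] x(1) \<open>e > 0\<close> by (auto simp: q_def)
    then obtain y where "f y < f x"
      by (auto simp: g_argmin_def f_def not_le)
    then have "f q < f x"
      using q_min[of y] by simp
    with x that show thesis by blast
  next
    case False
    \<comment> \<open>The interval is empty, so any bound above \<open>f q\<close> serves.\<close>
    then show thesis
      using that[of "f q + 1"] by auto
  qed
  have hq: "h i q > 0"
    unfolding q_def using h_phi_min_pos assms by simp
  \<comment> \<open>A change of the ratio by less than \<open>d\<close> raises the value at
    \<open>q\<close> by less than the gap, so the new minimiser cannot lie in the interval.\<close>
  define d where "d = (m - f q) / h i q"
  have "d > 0"
    using m(1) hq by (simp add: d_def)
  moreover have "dist (p i r') (p i r) < e" if "r' \<in> {r..}" "dist r' r < d" for r'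
  proof -
    have r': "r \<le> r'" "r' \<ge> 0" "(r' - r) * h i q < m - f q"
      using that assms(2) hq by (auto simp: d_def dist_real_def pos_less_divide_eq)
    have arg: "g_argmin i r' (p i r')"
      using g_argmin_phi_min r'(2) by simp
    have "r' * h i (p i r') + h s (p i r') \<le> r' * h i q + h s q"
      using arg by (simp add: g_argmin_def)
    also have "\<dots> < m"
      using r'(3) by (simp add: f_def algebra_simps)
    finally have "r' * h i (p i r') + h s (p i r') < m" .
    moreover have "r * h i (p i r') \<le> r' * h i (p i r')"
      using r'(1) log_dev_nonneg by (rule mult_right_mono)
    ultimately have "f (p i r') < m"
      by (simp add: f_def)
    then have "p i r' \<notin> {\<mu> $ i..q - e}"
      using m(2) by (meson not_le)
    then have "q - e < p i r'"
      using g_argmin_gt[OF assms(1) r'(2) arg] by auto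
    moreover have "p i r' \<le> q"
      unfolding q_def using phi_min_antimono assms r'(1) by simp
    ultimately show ?thesis
      by (simp add: dist_real_def q_def)
  qed
  ultimately show "\<exists>d>0. \<forall>x'\<in>{r..}. dist x' r < d \<longrightarrow> dist (p i x') (p i r) < e"
    by blast
qed

lemma rate_le: "\<lbrakk>a \<ge> 0; b \<ge> 0\<rbrakk> \<Longrightarrow> V i a b \<le> a / 2 * h i \<phi> + b / 2 * h s \<phi>"
  by (intro rate_fun_attained(2) var_pos)

text \<open>Dividing the weights by \<open>b\<close> turns the rate into \<open>b / 2\<close> times
  the minimum of the normalised function.\<close>

lemma rate_eq_phi_min:
  assumes "a \<ge> 0" "b > 0"
  shows "V i a b = a / 2 * h i (p i (a / b)) + b / 2 * h s (p i (a / b))"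
proof (rule antisym)
  show "V i a b \<le> a / 2 * h i (p i (a / b)) + b / 2 * h s (p i (a / b))"
    using assms by (intro rate_le) auto
  obtain \<phi> where \<phi>: "V i a b = a / 2 * h i \<phi> + b / 2 * h s \<phi>"
    using rate_fun_attained(1)[OF var_pos var_pos] assms by (metis less_imp_le)
  have "a / b * h i (p i (a / b)) + h s (p i (a / b)) \<le> a / b * h i \<phi> + h s \<phi>"
    using g_argmin_phi_min[of "a / b" i] assms by (simp add: g_argmin_def)
  then have "b / 2 * (a / b * h i (p i (a / b)) + h s (p i (a / b))) \<le> b / 2 * (a / b * h i \<phi> + h s \<phi>)"
    using assms(2) by (intro mult_left_mono) auto
  then show "a / 2 * h i (p i (a / b)) + b / 2 * h s (p i (a / b)) \<le> V i a b"
    unfolding \<phi> using assms(2) by (simp add: distrib_left)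
qed

lemma g_argminI:
  assumes "a \<ge> 0" "b > 0" "a / 2 * h i \<phi> + b / 2 * h s \<phi> \<le> V i a b"
  shows "g_argmin i (a / b) \<phi>"
  unfolding g_argmin_def
proof
  fix \<psi>
  have "a / 2 * h i \<phi> + b / 2 * h s \<phi> \<le> a / 2 * h i \<psi> + b / 2 * h s \<psi>"
    using assms(3) rate_le[of a b i \<psi>] assms by simp
  then have "2 / b * (a / 2 * h i \<phi> + b / 2 * h s \<phi>) \<le> 2 / b * (a / 2 * h i \<psi> + b / 2 * h s \<psi>)"
    using assms(2) by (intro mult_left_mono) auto
  then show "a / b * h i \<phi> + h s \<phi> \<le> a / b * h i \<psi> + h s \<psi>"
    using assms(2) by (simp add: distrib_left)
qed

text \<open>The case \<open>b = 0\<close> is included, with the point \<open>\<mu> $ i\<close>.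
  Confinement between the means bounds both deviations, which yields a Lipschitz estimate up to the
  boundary of the simplex.\<close>

lemma rate_attained_between:
  assumes "i \<noteq> s" "a \<ge> 0" "b \<ge> 0"
  obtains \<phi> where "\<mu> $ i \<le> \<phi>" "\<phi> \<le> \<mu> $ s" "V i a b = a / 2 * h i \<phi> + b / 2 * h s \<phi>"
proof (cases "b = 0")
  case True
  obtain \<psi> where \<psi>: "V i a b = a / 2 * h i \<psi> + b / 2 * h s \<psi>"
    using rate_fun_attained(1)[OF var_pos var_pos] assms by metis
  have "V i a b \<ge> 0"
    unfolding \<psi> using assms
    by (intro add_nonneg_nonneg mult_nonneg_nonneg log_dev_nonneg) auto
  moreover have "V i a b \<le> 0"
    using rate_le[of a b i "\<mu> $ i"] assms True by simp
  ultimately show thesis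
    using that[of "\<mu> $ i"] best[OF assms(1)] True by simp
next
  case False
  then have "g_argmin i (a / b) (p i (a / b))"
    using g_argmin_phi_min assms by simp
  then show thesis
    using that[of "p i (a / b)"] rate_eq_phi_min[of a b i] False assms
      g_argmin_gt[of i "a / b"] g_argmin_le[of i "a / b"]
    by (simp add: less_imp_le)
qed

lemma rate_nonneg:
  assumes "i \<noteq> s" "a \<ge> 0" "b \<ge> 0"
  shows "0 \<le> V i a b"
proof -
  obtain \<phi> where \<phi>: "V i a b = a / 2 * h i \<phi> + b / 2 * h s \<phi>"
    using rate_attained_between[OF assms] by blast
  show ?thesis
    unfolding \<phi> using assms by (intro add_nonneg_nonneg mult_nonneg_nonneg log_dev_nonneg) auto
qed

lemma rate_zero_left: "\<lbrakk>i \<noteq> s; b \<ge> 0\<rbrakk> \<Longrightarrow> V i 0 b = 0"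
  using rate_le[of 0 b i "\<mu> $ s"] rate_nonneg[of i 0 b] by simp

lemma rate_zero_right: "\<lbrakk>i \<noteq> s; a \<ge> 0\<rbrakk> \<Longrightarrow> V i a 0 = 0"
  using rate_le[of a 0 i "\<mu> $ i"] rate_nonneg[of i a 0] by simp

text \<open>The minimiser for \<open>a'\<close> is a test point for \<open>a\<close>, and the two
  values there differ by \<open>(a' - a) / 2\<close> times a positive deviation.\<close>

lemma rate_strict_mono:
  assumes "i \<noteq> s" "0 \<le> a" "a < a'" "b > 0"
  shows "V i a b < V i a' b"
proof -
  let ?\<phi> = "p i (a' / b)"
  have "V i a b \<le> a / 2 * h i ?\<phi> + b / 2 * h s ?\<phi>"
    using assms by (intro rate_le) auto
  also have "\<dots> < a' / 2 * h i ?\<phi> + b / 2 * h s ?\<phi>"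
    using assms h_phi_min_pos[of i "a' / b"] by simp
  also have "\<dots> = V i a' b"
    using assms by (intro rate_eq_phi_min[symmetric]) auto
  finally show ?thesis .
qed

lemma rate_less_iff:
  assumes "i \<noteq> s" "0 \<le> a" "0 \<le> a'" "b > 0"
  shows "V i a b < V i a' b \<longleftrightarrow> a < a'"
  using rate_strict_mono[of i a a' b] rate_strict_mono[of i a' a b] assms
  by (cases a a' rule: linorder_cases) auto

lemma rate_pos: "\<lbrakk>i \<noteq> s; a > 0; b > 0\<rbrakk> \<Longrightarrow> 0 < V i a b"
  using rate_strict_mono[of i 0 a b] rate_zero_left[of i b] by simp

lemma rate_homogeneous:
  assumes "a \<ge> 0" "b > 0"
  shows "V i a b = b * V i (a / b) 1"
  using rate_eq_phi_min[OF assms, of i] rate_eq_phi_min[of "a / b" 1 i] assms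
  by (simp add: field_simps)

text \<open>At a minimiser for \<open>t * a\<close> the first term scales exactly by
  \<open>t\<close>, while the second is nonnegative and hence at least \<open>t\<close> times
  itself. The bound controls the loss of the donor in the exchange argument.\<close>

lemma rate_scale_left:
  assumes "i \<noteq> s" "a \<ge> 0" "b \<ge> 0" "0 \<le> t" "t \<le> 1"
  shows "t * V i a b \<le> V i (t * a) b"
proof -
  obtain \<phi> where \<phi>: "V i (t * a) b = t * a / 2 * h i \<phi> + b / 2 * h s \<phi>"
    using assms by (meson rate_attained_between mult_nonneg_nonneg)
  have "t * V i a b \<le> t * (a / 2 * h i \<phi> + b / 2 * h s \<phi>)"
    using assms by (intro mult_left_mono rate_le)
  also have "\<dots> = t * a / 2 * h i \<phi> + t * (b / 2 * h s \<phi>)"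
    by (simp add: algebra_simps)
  also have "\<dots> \<le> t * a / 2 * h i \<phi> + b / 2 * h s \<phi>"
    using assms by (intro add_left_mono mult_left_le_one_le mult_nonneg_nonneg log_dev_nonneg) auto
  finally show ?thesis
    using \<phi> by simp
qed

(* Minimisers of different ratios are different, so V i is strictly concave across rays. *)
lemma rate_midpoint_strict:
  assumes "i \<noteq> s" "a > 0" "b > 0" "a' > 0" "b' > 0" "v \<le> V i a b" "v \<le> V i a' b'"
    and "a / b \<noteq> a' / b'"
  shows "v < V i ((a + a') / 2) ((b + b') / 2)"
proof (rule ccontr)
  assume not: "\<not> v < V i ((a + a') / 2) ((b + b') / 2)"
  define \<phi> where "\<phi> = p i ((a + a') / 2 / ((b + b') / 2))"
  have "V i ((a + a') / 2) ((b + b') / 2) = (a + a') / 2 / 2 * h i \<phi> + (b + b') / 2 / 2 * h s \<phi>"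
    unfolding \<phi>_def using assms by (intro rate_eq_phi_min) auto
  then have "2 * v \<ge> (a / 2 * h i \<phi> + b / 2 * h s \<phi>) + (a' / 2 * h i \<phi> + b' / 2 * h s \<phi>)"
    using not by (simp add: field_simps)
  moreover have "V i a b \<le> a / 2 * h i \<phi> + b / 2 * h s \<phi>" "V i a' b' \<le> a' / 2 * h i \<phi> + b' / 2 * h s \<phi>"
    using assms rate_le[of a b i \<phi>] rate_le[of a' b' i \<phi>] by simp_all
  ultimately have "a / 2 * h i \<phi> + b / 2 * h s \<phi> \<le> V i a b" "a' / 2 * h i \<phi> + b' / 2 * h s \<phi> \<le> V i a' b'"
    using assms(6,7) by linarith+
  then have "g_argmin i (a / b) \<phi>" "g_argmin i (a' / b') \<phi>"
    using assms by (auto intro!: g_argminI)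
  then have "a / b = a' / b'"
    using g_argmin_ratio_unique assms by (meson divide_nonneg_pos less_imp_le)
  with assms(8) show False by simp
qed

lemma rate_midpoint:
  assumes "i \<noteq> s" "a > 0" "b > 0" "a' > 0" "b' > 0" "v \<le> V i a b" "v \<le> V i a' b'"
  shows "v \<le> V i ((a + a') / 2) ((b + b') / 2)"
proof -
  define \<phi> where "\<phi> = p i ((a + a') / 2 / ((b + b') / 2))"
  have "V i ((a + a') / 2) ((b + b') / 2) = (a + a') / 2 / 2 * h i \<phi> + (b + b') / 2 / 2 * h s \<phi>"
    unfolding \<phi>_def using assms by (intro rate_eq_phi_min) auto
  then have "2 * V i ((a + a') / 2) ((b + b') / 2)
      = (a / 2 * h i \<phi> + b / 2 * h s \<phi>) + (a' / 2 * h i \<phi> + b' / 2 * h s \<phi>)"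
    by (simp add: field_simps)
  moreover have "V i a b \<le> a / 2 * h i \<phi> + b / 2 * h s \<phi>" "V i a' b' \<le> a' / 2 * h i \<phi> + b' / 2 * h s \<phi>"
    using assms rate_le[of a b i \<phi>] rate_le[of a' b' i \<phi>] by simp_all
  ultimately show ?thesis
    using assms(6,7) by linarith
qed

text \<open>A minimiser for \<open>(a, b)\<close> between the means is a test point for
  \<open>(a', b')\<close>; there each deviation is at most its value at the opposite mean.\<close>

lemma rate_lipschitz:
  assumes "i \<noteq> s" "a \<ge> 0" "b \<ge> 0" "a' \<ge> 0" "b' \<ge> 0"
  shows "V i a' b' - V i a b \<le> \<bar>a' - a\<bar> * h i (\<mu> $ s) + \<bar>b' - b\<bar> * h s (\<mu> $ i)"
proof -
  obtain \<phi> where \<phi>: "\<mu> $ i \<le> \<phi>" "\<phi> \<le> \<mu> $ s" "V i a b = a / 2 * h i \<phi> + b / 2 * h s \<phi>"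
    using rate_attained_between assms by metis
  have "V i a' b' - V i a b \<le> (a' / 2 * h i \<phi> + b' / 2 * h s \<phi>) - (a / 2 * h i \<phi> + b / 2 * h s \<phi>)"
    using rate_le[of a' b' i \<phi>] assms \<phi>(3) by simp
  also have "\<dots> = (a' - a) / 2 * h i \<phi> + (b' - b) / 2 * h s \<phi>"
    by (simp add: field_simps)
  also have "\<dots> \<le> \<bar>a' - a\<bar> * h i (\<mu> $ s) + \<bar>b' - b\<bar> * h s (\<mu> $ i)"
    using \<phi> log_dev_nonneg by (intro add_mono mult_mono log_dev_mono) (auto simp: abs_if)
  finally show ?thesis .
qed

lemma continuous_on_rate:
  assumes "i \<noteq> s" "\<And>\<alpha>. \<alpha> \<in> A \<Longrightarrow> \<alpha> $ i \<ge> 0 \<and> \<alpha> $ s \<ge> 0"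
  shows "continuous_on A (\<lambda>\<alpha>. V i (\<alpha> $ i) (\<alpha> $ s))"
proof -
  have "((\<lambda>\<beta>. V i (\<beta> $ i) (\<beta> $ s)) \<longlongrightarrow> V i (\<alpha> $ i) (\<alpha> $ s)) (at \<alpha> within A)" if "\<alpha> \<in> A" for \<alpha>
  proof (rule LIM_zero_cancel, rule Lim_null_comparison)
    let ?K = "\<lambda>\<beta>. \<bar>\<beta> $ i - \<alpha> $ i\<bar> * h i (\<mu> $ s) + \<bar>\<beta> $ s - \<alpha> $ s\<bar> * h s (\<mu> $ i)"
    have "\<bar>V i (\<beta> $ i) (\<beta> $ s) - V i (\<alpha> $ i) (\<alpha> $ s)\<bar> \<le> ?K \<beta>" if "\<beta> \<in> A" for \<beta>
      using rate_lipschitz[OF assms(1), of "\<alpha> $ i" "\<alpha> $ s" "\<beta> $ i" "\<beta> $ s"]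
        rate_lipschitz[OF assms(1), of "\<beta> $ i" "\<beta> $ s" "\<alpha> $ i" "\<alpha> $ s"]
        assms(2)[OF \<open>\<alpha> \<in> A\<close>] assms(2)[OF that]
      by (simp add: abs_le_iff abs_minus_commute)
    then show "\<forall>\<^sub>F \<beta> in at \<alpha> within A. norm (V i (\<beta> $ i) (\<beta> $ s) - V i (\<alpha> $ i) (\<alpha> $ s)) \<le> ?K \<beta>"
      by (auto simp: eventually_at_filter)
    have "(?K \<longlongrightarrow> \<bar>\<alpha> $ i - \<alpha> $ i\<bar> * h i (\<mu> $ s) + \<bar>\<alpha> $ s - \<alpha> $ s\<bar> * h s (\<mu> $ i)) (at \<alpha> within A)"
      by (intro tendsto_intros)
    then show "(?K \<longlongrightarrow> 0) (at \<alpha> within A)"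
      by simp
  qed
  then show ?thesis
    by (simp add: continuous_on_def)
qed

section \<open>The objective and its maxima\<close>

definition objective :: "real ^ 'k \<Rightarrow> real" where
  "objective \<alpha> = (MIN i\<in>{i. i \<noteq> s}. V i (\<alpha> $ i) (\<alpha> $ s))"

lemma others_nonempty: "{i. i \<noteq> s} \<noteq> {}"
  using other by auto

lemma objective_le: "i \<noteq> s \<Longrightarrow> objective \<alpha> \<le> V i (\<alpha> $ i) (\<alpha> $ s)"
  unfolding objective_def by (rule Min_le) auto

lemma less_objective_iff: "v < objective \<alpha> \<longleftrightarrow> (\<forall>i. i \<noteq> s \<longrightarrow> v < V i (\<alpha> $ i) (\<alpha> $ s))"
  unfolding objective_def using others_nonempty by (subst Min_gr_iff) auto

lemma le_objective_iff: "v \<le> objective \<alpha> \<longleftrightarrow> (\<forall>i. i \<noteq> s \<longrightarrow> v \<le> V i (\<alpha> $ i) (\<alpha> $ s))"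
  unfolding objective_def using others_nonempty by (subst Min_ge_iff) auto

lemma objective_attained: obtains i where "i \<noteq> s" "objective \<alpha> = V i (\<alpha> $ i) (\<alpha> $ s)"
proof -
  have "objective \<alpha> \<in> (\<lambda>i. V i (\<alpha> $ i) (\<alpha> $ s)) ` {i. i \<noteq> s}"
    unfolding objective_def using others_nonempty by (intro Min_in) auto
  with that show thesis by auto
qed

lemma optimal_iff: "optimal \<mu> \<sigma> s \<alpha> \<longleftrightarrow> feasible \<alpha> \<and> (\<forall>\<beta>. feasible \<beta> \<longrightarrow> objective \<beta> \<le> objective \<alpha>)"
  by (auto simp: optimal_def is_arg_max_def objective_def not_less)

lemma compact_feasible: "compact {\<alpha> :: real ^ 'k. feasible \<alpha>}"
proof -
  have "{\<alpha> :: real ^ 'k. feasible \<alpha>} =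
      {\<alpha>. (\<Sum>i\<in>UNIV. \<alpha> $ i) = 1} \<inter> (\<Inter>i. {\<alpha>. 0 \<le> \<alpha> $ i})"
    by (auto simp: feasible_def)
  moreover have "closed \<dots>"
    by (intro closed_Int closed_INT ballI closed_Collect_eq closed_Collect_le continuous_intros)
  moreover have "bounded {\<alpha> :: real ^ 'k. feasible \<alpha>}"
    unfolding bounded_iff
  proof (intro exI ballI)
    fix \<alpha> :: "real ^ 'k"
    assume "\<alpha> \<in> {\<alpha>. feasible \<alpha>}"
    then show "norm \<alpha> \<le> 1"
      using norm_le_l1_cart[of \<alpha>] by (simp add: feasible_def)
  qed
  ultimately show ?thesis
    by (simp add: compact_eq_bounded_closed)
qed

text \<open>Compactness with an arbitrary closed constraint serves both the whole simplex and the
  slices with \<open>\<alpha> $ s\<close> prescribed.\<close>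

lemma objective_attains_max:
  assumes "closed C" "\<beta> \<in> C" "feasible \<beta>"
  obtains \<alpha> where "\<alpha> \<in> C" "feasible \<alpha>" "\<And>\<gamma>. \<lbrakk>\<gamma> \<in> C; feasible \<gamma>\<rbrakk> \<Longrightarrow> objective \<gamma> \<le> objective \<alpha>"
proof -
  let ?A = "C \<inter> {\<alpha>. feasible \<alpha>}"
  have "continuous_on ?A objective"
    unfolding objective_def using others_nonempty
    by (intro continuous_on_Min_image continuous_on_rate) (auto simp: feasible_def)
  then have "\<exists>x\<in>?A. \<forall>y\<in>?A. objective y \<le> objective x"
    using assms compact_feasible by (intro continuous_attains_sup closed_Int_compact) auto
  with that show thesis by auto
qed

section \<open>Slices with prescribed weight of the best alternative\<close>

lemma sum_split: "(\<Sum>i\<in>UNIV. f i) = f s + (\<Sum>i\<in>{i. i \<noteq> s}. f i)" for f :: "'k \<Rightarrow> real"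
proof -
  have "UNIV - {s} = {i. i \<noteq> s}" by auto
  then show ?thesis by (simp add: sum.remove[of UNIV s])
qed

(* If one rate exceeded the minimum, moving a little weight to the remaining alternatives
   would increase the minimum. *)
lemma slice_max_equalises:
  assumes "feasible \<alpha>" "\<alpha> $ s > 0"
    and max: "\<And>\<gamma>. \<lbrakk>feasible \<gamma>; \<gamma> $ s = \<alpha> $ s\<rbrakk> \<Longrightarrow> objective \<gamma> \<le> objective \<alpha>"
    and "j \<noteq> s"
  shows "V j (\<alpha> $ j) (\<alpha> $ s) = objective \<alpha>"
proof (rule ccontr)
  assume "V j (\<alpha> $ j) (\<alpha> $ s) \<noteq> objective \<alpha>"
  then have less: "objective \<alpha> < V j (\<alpha> $ j) (\<alpha> $ s)"
    using objective_le[OF \<open>j \<noteq> s\<close>, of \<alpha>] by simp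
  have nonneg: "\<alpha> $ i \<ge> 0" for i
    using assms(1) by (simp add: feasible_def)
  have obj_nonneg: "0 \<le> objective \<alpha>"
    using nonneg rate_nonneg by (simp add: le_objective_iff)
  have "\<alpha> $ j \<noteq> 0"
    using less obj_nonneg rate_zero_left[OF \<open>j \<noteq> s\<close>, of "\<alpha> $ s"] assms(2) by auto
  then have aj: "\<alpha> $ j > 0"
    using nonneg[of j] by simp
  have "objective \<alpha> / V j (\<alpha> $ j) (\<alpha> $ s) < 1"
    using less obj_nonneg by (simp add: divide_less_eq)
  \<comment> \<open>Any such \<open>t\<close> leaves alternative \<open>j\<close> above the old
    minimum after its weight shrinks to \<open>t * \<alpha> $ j\<close>, by
    \<open>rate_scale_left\<close>.\<close>
  then obtain t where t: "objective \<alpha> / V j (\<alpha> $ j) (\<alpha> $ s) < t" "t < 1"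
    using dense by blast
  then have t0: "0 < t"
    using obj_nonneg less by (meson divide_nonneg_pos le_less_trans)
  define R where "R = {i. i \<noteq> s \<and> i \<noteq> j}"
  \<comment> \<open>An index attaining the minimum differs from \<open>j\<close>, so
    \<open>R\<close> is nonempty and there is someone to receive weight.\<close>
  obtain l where "l \<noteq> s" "objective \<alpha> = V l (\<alpha> $ l) (\<alpha> $ s)"
    using objective_attained .
  then have "l \<in> R"
    using less by (auto simp: R_def)
  then have cardR: "card R > 0"
    by (auto simp: card_gt_0_iff)
  \<comment> \<open>The weight released by \<open>j\<close> is shared equally over
    \<open>R\<close>.\<close>
  define \<delta> where "\<delta> = (1 - t) * \<alpha> $ j / card R"
  have "\<delta> > 0"
    using t aj cardR by (simp add: \<delta>_def)
  define \<gamma> where "\<gamma> = (\<chi> i. if i = s then \<alpha> $ s else if i = j then t * \<alpha> $ j else \<alpha> $ i + \<delta>)"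
  have split: "(\<Sum>i\<in>UNIV. f i) = f s + f j + (\<Sum>i\<in>R. f i)" for f :: "'k \<Rightarrow> real"
  proof -
    have "{i. i \<noteq> s} = insert j R" "j \<notin> R"
      using \<open>j \<noteq> s\<close> by (auto simp: R_def)
    then show ?thesis by (simp add: sum_split)
  qed
  have "(\<Sum>i\<in>R. \<gamma> $ i) = (\<Sum>i\<in>R. \<alpha> $ i + \<delta>)"
    by (rule sum.cong) (auto simp: \<gamma>_def R_def)
  also have "\<dots> = (\<Sum>i\<in>R. \<alpha> $ i) + (1 - t) * \<alpha> $ j"
    using cardR by (simp add: sum.distrib \<delta>_def card_gt_0_iff)
  finally have "(\<Sum>i\<in>UNIV. \<gamma> $ i) = (\<Sum>i\<in>UNIV. \<alpha> $ i)"
    using \<open>j \<noteq> s\<close> by (simp add: split) (simp add: \<gamma>_def algebra_simps)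
  then have "feasible \<gamma>"
    using assms(1) t0 \<open>\<delta> > 0\<close> by (auto simp: feasible_def \<gamma>_def)
  moreover have "\<gamma> $ s = \<alpha> $ s"
    by (simp add: \<gamma>_def)
  moreover have "objective \<alpha> < objective \<gamma>"
    unfolding less_objective_iff
  proof (intro allI impI)
    fix i
    assume "i \<noteq> s"
    show "objective \<alpha> < V i (\<gamma> $ i) (\<gamma> $ s)"
    proof (cases "i = j")
      case True
      have "objective \<alpha> < t * V j (\<alpha> $ j) (\<alpha> $ s)"
        using t(1) less obj_nonneg by (simp add: divide_less_eq)
      also have "\<dots> \<le> V j (t * \<alpha> $ j) (\<alpha> $ s)"
        using \<open>j \<noteq> s\<close> nonneg t t0 by (intro rate_scale_left) auto
      finally show ?thesis
        using True \<open>j \<noteq> s\<close> by (simp add: \<gamma>_def)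
    next
      case False
      have "objective \<alpha> \<le> V i (\<alpha> $ i) (\<alpha> $ s)"
        by (rule objective_le) fact
      also have "\<dots> < V i (\<alpha> $ i + \<delta>) (\<alpha> $ s)"
        using \<open>i \<noteq> s\<close> nonneg \<open>\<delta> > 0\<close> assms(2) by (intro rate_strict_mono) auto
      finally show ?thesis
        using False \<open>i \<noteq> s\<close> by (simp add: \<gamma>_def)
    qed
  qed
  ultimately show False
    using max by (meson not_le)
qed

text \<open>The property singled out in \<open>alpha_f\<close>, named so that existence and
  uniqueness can be proved before the description operator is evaluated.\<close>

definition balanced :: "real \<Rightarrow> real ^ 'k \<Rightarrow> bool" where
  "balanced b \<alpha> \<longleftrightarrow> (\<forall>i. \<alpha> $ i > 0) \<and> (\<Sum>i\<in>UNIV. \<alpha> $ i) = 1 \<and> \<alpha> $ s = b \<and>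
     (\<forall>i j. i \<noteq> s \<longrightarrow> j \<noteq> s \<longrightarrow> V i (\<alpha> $ i) b = V j (\<alpha> $ j) b)"

lemma alpha_f_eq_The: "alpha_f \<mu> \<sigma> s b = (THE \<alpha>. balanced b \<alpha>)"
  by (simp add: alpha_f_def balanced_def)

lemma balanced_feasible: "balanced b \<alpha> \<Longrightarrow> feasible \<alpha>"
  by (auto simp: balanced_def feasible_def less_imp_le)

lemma balanced_objective:
  assumes "balanced b \<alpha>" "i \<noteq> s"
  shows "V i (\<alpha> $ i) b = objective \<alpha>"
proof -
  obtain j where "j \<noteq> s" "objective \<alpha> = V j (\<alpha> $ j) (\<alpha> $ s)"
    using objective_attained .
  moreover have "V i (\<alpha> $ i) b = V j (\<alpha> $ j) b" "\<alpha> $ s = b"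
    using assms \<open>j \<noteq> s\<close> unfolding balanced_def by blast+
  ultimately show ?thesis
    by simp
qed

lemma balanced_sum_others: "balanced b \<alpha> \<Longrightarrow> (\<Sum>i\<in>{i. i \<noteq> s}. \<alpha> $ i) = 1 - b"
  using sum_split[of "\<lambda>i. \<alpha> $ i"] by (simp add: balanced_def)

(* All ratios to b move in the same direction, because the rates V i (a / b) 1 are equal,
   and their sum (1 - b) / b is decreasing. *)
lemma balanced_ratio_antimono:
  assumes "balanced b \<alpha>" "balanced b' \<alpha>'" "b \<le> b'" "i \<noteq> s"
  shows "\<alpha>' $ i / b' \<le> \<alpha> $ i / b"
proof (rule ccontr)
  assume not: "\<not> \<alpha>' $ i / b' \<le> \<alpha> $ i / b"
  have b: "b > 0" "b' > 0"
    using assms by (auto simp: balanced_def)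
  have pos: "\<alpha> $ j > 0" "\<alpha>' $ j > 0" for j
    using assms by (auto simp: balanced_def)
  \<comment> \<open>Homogeneity turns the common rate into a common rate of the ratios, so a strict
    comparison for one alternative carries over to all.\<close>
  have unit: "V j (\<alpha> $ j / b) 1 = objective \<alpha> / b" "V j (\<alpha>' $ j / b') 1 = objective \<alpha>' / b'"
    if "j \<noteq> s" for j
    using rate_homogeneous[of "\<alpha> $ j" b j] rate_homogeneous[of "\<alpha>' $ j" b' j] b pos[of j]
      balanced_objective[OF assms(1) that] balanced_objective[OF assms(2) that]
    by (simp_all add: field_simps)
  have "V i (\<alpha> $ i / b) 1 < V i (\<alpha>' $ i / b') 1"
    using not assms(4) b pos[of i] by (intro rate_strict_mono) auto
  then have "objective \<alpha> / b < objective \<alpha>' / b'"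
    using unit assms(4) by simp
  then have "\<alpha> $ j / b < \<alpha>' $ j / b'" if "j \<noteq> s" for j
    using rate_less_iff[of j "\<alpha> $ j / b" "\<alpha>' $ j / b'" 1] unit[OF that] that b pos[of j] by simp
  then have "(\<Sum>j\<in>{j. j \<noteq> s}. \<alpha> $ j / b) < (\<Sum>j\<in>{j. j \<noteq> s}. \<alpha>' $ j / b')"
    using others_nonempty by (intro sum_strict_mono) auto
  then have "(1 - b) / b < (1 - b') / b'"
    using balanced_sum_others[OF assms(1)] balanced_sum_others[OF assms(2)]
    by (simp add: sum_divide_distrib[symmetric])
  then have "b' < b"
    using b by (simp add: field_simps)
  with assms(3) show False by simp
qed

text \<open>The antimonotonicity of the ratios applies in both directions when the weights of the
  best alternative agree.\<close>

lemma balanced_unique: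
  assumes "balanced b \<alpha>" "balanced b \<alpha>'"
  shows "\<alpha> = \<alpha>'"
proof (rule vec_eq_iff[THEN iffD2], rule allI)
  fix i
  have "b > 0"
    using assms by (auto simp: balanced_def)
  show "\<alpha> $ i = \<alpha>' $ i"
  proof (cases "i = s")
    case True
    then show ?thesis using assms by (simp add: balanced_def)
  next
    case False
    have "\<alpha> $ i / b = \<alpha>' $ i / b"
      using balanced_ratio_antimono[OF assms _ False] balanced_ratio_antimono[OF assms(2,1) _ False]
      by (intro antisym) auto
    then show ?thesis using \<open>b > 0\<close> by simp
  qed
qed

text \<open>A rate with a zero weight vanishes, so a positive objective forces every weight to be
  positive; equal rates come from the exchange argument.\<close>

lemma slice_max_balanced:
  assumes "feasible \<alpha>" "\<alpha> $ s > 0" "objective \<alpha> > 0"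
    and max: "\<And>\<gamma>. \<lbrakk>feasible \<gamma>; \<gamma> $ s = \<alpha> $ s\<rbrakk> \<Longrightarrow> objective \<gamma> \<le> objective \<alpha>"
  shows "balanced (\<alpha> $ s) \<alpha>"
  unfolding balanced_def
proof (intro conjI allI impI)
  have eq: "V i (\<alpha> $ i) (\<alpha> $ s) = objective \<alpha>" if "i \<noteq> s" for i
    using slice_max_equalises[OF assms(1,2) max that] by simp
  then show "V i (\<alpha> $ i) (\<alpha> $ s) = V j (\<alpha> $ j) (\<alpha> $ s)" if "i \<noteq> s" "j \<noteq> s" for i j
    using that by simp
  show "\<alpha> $ i > 0" for i
  proof (cases "i = s")
    case False
    then have "\<alpha> $ i \<noteq> 0"
      using eq[of i] rate_zero_left[of i "\<alpha> $ s"] assms(2,3) by auto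
    then show ?thesis
      using assms(1) by (simp add: feasible_def less_le)
  qed (use assms in simp)
qed (use assms in \<open>auto simp: feasible_def\<close>)

text \<open>Makes slice maxima and the global maximum positive, which excludes zero weights
  there.\<close>

lemma positive_point:
  assumes "0 < b" "b < 1"
  obtains \<beta> where "feasible \<beta>" "\<beta> $ s = b" "objective \<beta> > 0"
proof
  define \<beta> :: "real ^ 'k" where "\<beta> = (\<chi> i. if i = s then b else (1 - b) / card {i. i \<noteq> s})"
  have card: "card {i. i \<noteq> s} > 0"
    using others_nonempty by (simp add: card_gt_0_iff)
  have "(\<Sum>i\<in>{i. i \<noteq> s}. \<beta> $ i) = (\<Sum>i\<in>{i. i \<noteq> s}. (1 - b) / card {i. i \<noteq> s})"
    by (rule sum.cong) (auto simp: \<beta>_def)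
  also have "\<dots> = 1 - b"
    using others_nonempty by simp
  finally have "(\<Sum>i\<in>UNIV. \<beta> $ i) = 1"
    by (simp add: sum_split) (simp add: \<beta>_def)
  then show "feasible \<beta>"
    using assms by (auto simp: feasible_def \<beta>_def)
  show "\<beta> $ s = b"
    by (simp add: \<beta>_def)
  have "\<beta> $ i > 0" for i
    using assms card by (auto simp: \<beta>_def)
  then show "objective \<beta> > 0"
    using rate_pos by (simp add: less_objective_iff)
qed

text \<open>A maximiser over the slice, available by compactness, is the required vector.\<close>

lemma balanced_exists:
  assumes "0 < b" "b < 1"
  obtains \<alpha> where "balanced b \<alpha>"
proof -
  obtain \<beta> where \<beta>: "feasible \<beta>" "\<beta> $ s = b" "objective \<beta> > 0"
    using positive_point[OF assms] .
  have "closed {\<alpha> :: real ^ 'k. \<alpha> $ s = b}"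
    by (intro closed_Collect_eq continuous_intros)
  then obtain \<alpha> where \<alpha>: "\<alpha> \<in> {\<alpha>. \<alpha> $ s = b}" "feasible \<alpha>"
      "\<And>\<gamma>. \<lbrakk>\<gamma> \<in> {\<alpha>. \<alpha> $ s = b}; feasible \<gamma>\<rbrakk> \<Longrightarrow> objective \<gamma> \<le> objective \<alpha>"
    using objective_attains_max[of "{\<alpha>. \<alpha> $ s = b}" \<beta>] \<beta> by blast
  have "objective \<alpha> > 0"
    using \<alpha>(3)[of \<beta>] \<beta> by simp
  then have "balanced (\<alpha> $ s) \<alpha>"
    using \<alpha> assms by (intro slice_max_balanced) auto
  with \<alpha>(1) that show thesis by simp
qed

lemma alpha_f_eq: "balanced b \<alpha> \<Longrightarrow> alpha_f \<mu> \<sigma> s b = \<alpha>"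
  unfolding alpha_f_eq_The using balanced_unique by (intro the_equality) auto

lemma balanced_alpha_f: "\<lbrakk>0 < b; b < 1\<rbrakk> \<Longrightarrow> balanced b (alpha_f \<mu> \<sigma> s b)"
  using balanced_exists alpha_f_eq by metis

section \<open>Existence and uniqueness of the optimal allocation\<close>

lemma optimal_exists: "\<exists>\<alpha>. optimal \<mu> \<sigma> s \<alpha>"
proof -
  obtain \<beta> :: "real ^ 'k" where "feasible \<beta>"
    by (rule positive_point[of "1 / 2"]) auto
  then show ?thesis
    using objective_attains_max[of UNIV \<beta>] by (auto simp: optimal_iff)
qed

text \<open>A global maximiser also maximises on its own slice. Its value is positive by comparison
  with a positive point, so it cannot give weight 0 to \<open>s\<close>.\<close>

lemma optimal_balanced:
  assumes "optimal \<mu> \<sigma> s \<alpha>"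
  shows "balanced (\<alpha> $ s) \<alpha>"
proof -
  have feas: "feasible \<alpha>" and max: "\<And>\<beta>. feasible \<beta> \<Longrightarrow> objective \<beta> \<le> objective \<alpha>"
    using assms by (auto simp: optimal_iff)
  obtain \<beta> where "feasible \<beta>" "objective \<beta> > 0"
    by (rule positive_point[of "1 / 2"]) auto
  then have pos: "objective \<alpha> > 0"
    using max[of \<beta>] by simp
  moreover have "\<alpha> $ s \<noteq> 0"
  proof
    assume "\<alpha> $ s = 0"
    obtain j where "j \<noteq> s" using other by blast
    then show False
      using objective_le[of j \<alpha>] pos rate_zero_right[of j "\<alpha> $ j"] feas \<open>\<alpha> $ s = 0\<close>
      by (simp add: feasible_def)
  qed
  then have "\<alpha> $ s > 0"
    using feas by (simp add: feasible_def less_le)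
  ultimately show ?thesis
    using feas max by (intro slice_max_balanced)
qed

lemma balanced_bounds:
  assumes "balanced b \<alpha>"
  shows "0 < b" "b < 1"
proof -
  show "0 < b"
    using assms by (auto simp: balanced_def)
  have "(\<Sum>i\<in>{i. i \<noteq> s}. \<alpha> $ i) > 0"
    using assms others_nonempty by (intro sum_pos) (auto simp: balanced_def)
  then show "b < 1"
    using balanced_sum_others[OF assms] by simp
qed

lemma optimal_unique:
  assumes "optimal \<mu> \<sigma> s \<alpha>" "optimal \<mu> \<sigma> s \<beta>"
  shows "\<alpha> = \<beta>"
proof -
  define v where "v = objective \<alpha>"
  have v: "objective \<beta> = v"
    unfolding v_def using assms by (intro antisym) (auto simp: optimal_iff)
  have bal: "balanced (\<alpha> $ s) \<alpha>" "balanced (\<beta> $ s) \<beta>"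
    using assms optimal_balanced by auto
  then have pos: "\<alpha> $ i > 0" "\<beta> $ i > 0" for i
    by (auto simp: balanced_def)
  have rate: "V i (\<alpha> $ i) (\<alpha> $ s) = v" "V i (\<beta> $ i) (\<beta> $ s) = v" if "i \<noteq> s" for i
    using balanced_objective that bal v by (auto simp: v_def)
  \<comment> \<open>The midpoint of two optimal allocations is again optimal by concavity, hence
    balanced with the same value \<open>v\<close>.\<close>
  define \<gamma> where "\<gamma> = (\<chi> i. (\<alpha> $ i + \<beta> $ i) / 2)"
  have sums: "(\<Sum>i\<in>UNIV. \<alpha> $ i) = 1" "(\<Sum>i\<in>UNIV. \<beta> $ i) = 1"
    using bal by (auto simp: balanced_def)
  then have "(\<Sum>i\<in>UNIV. \<gamma> $ i) = 1"
    by (simp add: \<gamma>_def sum_divide_distrib[symmetric] sum.distrib)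
  moreover have \<gamma>_pos: "\<gamma> $ i > 0" for i
    using pos[of i] by (simp add: \<gamma>_def)
  ultimately have feas: "feasible \<gamma>"
    by (simp add: feasible_def less_imp_le)
  moreover have "v \<le> objective \<gamma>"
    unfolding le_objective_iff \<gamma>_def using rate pos by (auto intro!: rate_midpoint)
  ultimately have opt: "optimal \<mu> \<sigma> s \<gamma>" and "objective \<gamma> = v"
    using assms(1) v_def unfolding optimal_iff by (meson order_trans antisym)+
  then have "V i (\<gamma> $ i) (\<gamma> $ s) = v" if "i \<noteq> s" for i
    using balanced_objective[OF optimal_balanced[OF opt] that] by simp
  \<comment> \<open>As every rate at the midpoint equals \<open>v\<close>, strict concavity leaves
    no room for different ratios.\<close>
  then have ratio: "\<alpha> $ i / \<alpha> $ s = \<beta> $ i / \<beta> $ s" if "i \<noteq> s" for i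
    using rate_midpoint_strict[of i "\<alpha> $ i" "\<alpha> $ s" "\<beta> $ i" "\<beta> $ s" v] rate pos that
    by (auto simp: \<gamma>_def)
  \<comment> \<open>Over all indices, including \<open>s\<close>, the ratios sum to the reciprocal
    of the weight of \<open>s\<close>, because each allocation sums to 1.\<close>
  then have "(\<Sum>i\<in>UNIV. \<alpha> $ i / \<alpha> $ s) = (\<Sum>i\<in>UNIV. \<beta> $ i / \<beta> $ s)"
    using pos[of s] by (intro sum.cong) (metis div_self less_irrefl, metis div_self less_irrefl)
  then have "\<alpha> $ s = \<beta> $ s"
    using sums by (simp add: sum_divide_distrib[symmetric])
  with bal show ?thesis
    using balanced_unique by simp
qed

section \<open>The sum of ratios and the slope of the slice maximum\<close>

definition ratio_sum :: "real \<Rightarrow> real" where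
  "ratio_sum b = (\<Sum>i\<in>{i. i \<noteq> s}. U_star_min \<mu> \<sigma> s i (r_f \<mu> \<sigma> s i b) / U_min \<mu> \<sigma> s i (r_f \<mu> \<sigma> s i b))"

(* The supergradient inequalities of the V i, scaled by 2 / u i, are added up; the allocations
   drop out because both vectors sum to 1. *)
lemma ratio_sum_supergradient:
  assumes "balanced b \<alpha>" "balanced b' \<alpha>'"
  shows "\<exists>c>0. c * (objective \<alpha>' - objective \<alpha>) \<le> (b' - b) * (ratio_sum b - 1)"
proof -
  have b: "b > 0" "b' > 0"
    using assms by (auto simp: balanced_def)
  have pos: "\<alpha> $ j > 0" "\<alpha>' $ j > 0" for j
    using assms by (auto simp: balanced_def)
  \<comment> \<open>\<open>u i / 2\<close> and \<open>w i / 2\<close> form a supergradient of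
    \<open>V i\<close> at \<open>(\<alpha> $ i, b)\<close>: they come from the minimiser there,
    which is a test point for any other weights.\<close>
  define u w where "u i = h i (p i (\<alpha> $ i / b))" and "w i = h s (p i (\<alpha> $ i / b))" for i
  have u_pos: "u i > 0" if "i \<noteq> s" for i
    unfolding u_def using h_phi_min_pos[OF that] b pos[of i] by simp
  have G: "ratio_sum b = (\<Sum>i\<in>{i. i \<noteq> s}. w i / u i)"
    by (simp add: ratio_sum_def U_star_min_def U_min_def r_f_def alpha_f_eq[OF assms(1)] u_def w_def)
  have "2 / u i * (objective \<alpha>' - objective \<alpha>) \<le> (\<alpha>' $ i - \<alpha> $ i) + (b' - b) * (w i / u i)"
    if "i \<noteq> s" for i
  proof -
    have "objective \<alpha> = \<alpha> $ i / 2 * u i + b / 2 * w i"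
      using rate_eq_phi_min[of "\<alpha> $ i" b i] balanced_objective[OF assms(1) that] pos[of i] b
      by (simp add: u_def w_def)
    moreover have "objective \<alpha>' \<le> \<alpha>' $ i / 2 * u i + b' / 2 * w i"
      using rate_le[of "\<alpha>' $ i" b' i] balanced_objective[OF assms(2) that] pos[of i] b
      by (simp add: u_def w_def less_imp_le)
    ultimately have "2 * (objective \<alpha>' - objective \<alpha>) \<le> (\<alpha>' $ i - \<alpha> $ i) * u i + (b' - b) * w i"
      by (simp add: algebra_simps)
    then have "2 * (objective \<alpha>' - objective \<alpha>) / u i
        \<le> ((\<alpha>' $ i - \<alpha> $ i) * u i + (b' - b) * w i) / u i"
      using u_pos[OF that] by (intro divide_right_mono) auto
    then show ?thesis
      using u_pos[OF that] by (simp add: add_divide_distrib)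
  qed
  then have "(\<Sum>i\<in>{i. i \<noteq> s}. 2 / u i * (objective \<alpha>' - objective \<alpha>))
      \<le> (\<Sum>i\<in>{i. i \<noteq> s}. (\<alpha>' $ i - \<alpha> $ i) + (b' - b) * (w i / u i))"
    by (intro sum_mono) auto
  \<comment> \<open>The weights of the competitors sum to \<open>1 - b\<close> and
    \<open>1 - b'\<close>, so their differences contribute \<open>b - b'\<close>; this produces the
    \<open>- 1\<close>.\<close>
  also have "\<dots> = (b' - b) * (ratio_sum b - 1)"
    unfolding G sum.distrib sum_subtractf sum_distrib_left[symmetric]
    using balanced_sum_others[OF assms(1)] balanced_sum_others[OF assms(2)]
    by (simp add: algebra_simps)
  finally have "(\<Sum>i\<in>{i. i \<noteq> s}. 2 / u i) * (objective \<alpha>' - objective \<alpha>) \<le> (b' - b) * (ratio_sum b - 1)"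
    by (simp add: sum_distrib_right)
  moreover have "(\<Sum>i\<in>{i. i \<noteq> s}. 2 / u i) > 0"
    using u_pos others_nonempty by (intro sum_pos) auto
  ultimately show ?thesis by blast
qed

text \<open>By uniqueness the optimum strictly beats the balanced vector of any other slice. The
  supergradient inequality then gives \<open>\<alpha> $ s - b\<close> and
  \<open>ratio_sum b - 1\<close> the same strict sign.\<close>

lemma optimal_ratio_sum:
  assumes "optimal \<mu> \<sigma> s \<alpha>" "0 < b" "b < 1"
  shows "b < \<alpha> $ s \<Longrightarrow> 1 < ratio_sum b" and "\<alpha> $ s < b \<Longrightarrow> ratio_sum b < 1"
proof -
  define \<beta> where "\<beta> = alpha_f \<mu> \<sigma> s b"
  have \<beta>: "balanced b \<beta>"
    unfolding \<beta>_def using balanced_alpha_f assms by simp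
  obtain c where c: "c > 0" "c * (objective \<alpha> - objective \<beta>) \<le> (\<alpha> $ s - b) * (ratio_sum b - 1)"
    using ratio_sum_supergradient[OF \<beta> optimal_balanced[OF assms(1)]] by blast
  have "0 < (\<alpha> $ s - b) * (ratio_sum b - 1)" if "\<alpha> $ s \<noteq> b"
  proof -
    have "\<not> optimal \<mu> \<sigma> s \<beta>"
      using optimal_unique[OF assms(1), of \<beta>] that \<beta> by (auto simp: balanced_def)
    then have "objective \<beta> < objective \<alpha>"
      using assms(1) balanced_feasible[OF \<beta>] unfolding optimal_iff by (meson not_le order_trans)
    then have "0 < c * (objective \<alpha> - objective \<beta>)"
      using c(1) by simp
    with c(2) show ?thesis by simp
  qed
  then show "b < \<alpha> $ s \<Longrightarrow> 1 < ratio_sum b" and "\<alpha> $ s < b \<Longrightarrow> ratio_sum b < 1"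
    by (auto simp: zero_less_mult_iff)
qed

section \<open>Left continuity of the sum of ratios\<close>

text \<open>No ratio decreases when \<open>b\<close> moves left, so the increment of one ratio is at
  most that of their sum, which is explicitly \<open>(1 - b) / b\<close>. The second claim records
  an approach from above, as right continuity of \<open>phi_min\<close> requires.\<close>

lemma r_f_left_limit:
  assumes "0 < b" "b < 1" "i \<noteq> s"
  shows "(r_f \<mu> \<sigma> s i \<longlongrightarrow> r_f \<mu> \<sigma> s i b) (at_left b)"
    and "\<forall>\<^sub>F b' in at_left b. r_f \<mu> \<sigma> s i b' \<in> {r_f \<mu> \<sigma> s i b..}"
proof -
  have ev: "\<forall>\<^sub>F b' in at_left b. 0 < b' \<and> b' < b"
    using eventually_at_left_real[OF assms(1)] by simp
  have mono: "r_f \<mu> \<sigma> s j b \<le> r_f \<mu> \<sigma> s j b'" if "0 < b'" "b' < b" "j \<noteq> s" for j b'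
    unfolding r_f_def using balanced_ratio_antimono[OF balanced_alpha_f balanced_alpha_f] that assms
    by simp
  have sum: "(\<Sum>j\<in>{j. j \<noteq> s}. r_f \<mu> \<sigma> s j b') = (1 - b') / b'" if "0 < b'" "b' < 1" for b'
    unfolding r_f_def sum_divide_distrib[symmetric]
    using balanced_sum_others[OF balanced_alpha_f[OF that]] by simp
  have upper: "r_f \<mu> \<sigma> s i b' \<le> r_f \<mu> \<sigma> s i b + ((1 - b') / b' - (1 - b) / b)" if "0 < b'" "b' < b" for b'
  proof -
    have "r_f \<mu> \<sigma> s i b' - r_f \<mu> \<sigma> s i b \<le> (\<Sum>j\<in>{j. j \<noteq> s}. r_f \<mu> \<sigma> s j b' - r_f \<mu> \<sigma> s j b)"
      using mono that assms(3) by (intro member_le_sum) auto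
    also have "\<dots> = (1 - b') / b' - (1 - b) / b"
      using that assms by (simp add: sum_subtractf sum)
    finally show ?thesis by simp
  qed
  show "\<forall>\<^sub>F b' in at_left b. r_f \<mu> \<sigma> s i b' \<in> {r_f \<mu> \<sigma> s i b..}"
    using ev by eventually_elim (use mono assms(3) in auto)
  have "((\<lambda>b'. r_f \<mu> \<sigma> s i b + ((1 - b') / b' - (1 - b) / b)) \<longlongrightarrow>
      r_f \<mu> \<sigma> s i b + ((1 - b) / b - (1 - b) / b)) (at_left b)"
    using assms by (intro tendsto_intros) auto
  then have lim: "((\<lambda>b'. r_f \<mu> \<sigma> s i b + ((1 - b') / b' - (1 - b) / b)) \<longlongrightarrow> r_f \<mu> \<sigma> s i b) (at_left b)"
    by simp
  show "(r_f \<mu> \<sigma> s i \<longlongrightarrow> r_f \<mu> \<sigma> s i b) (at_left b)"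
  proof (rule tendsto_sandwich[OF _ _ tendsto_const lim])
    show "\<forall>\<^sub>F b' in at_left b. r_f \<mu> \<sigma> s i b \<le> r_f \<mu> \<sigma> s i b'"
      using ev by eventually_elim (use mono assms(3) in auto)
    show "\<forall>\<^sub>F b' in at_left b. r_f \<mu> \<sigma> s i b' \<le> r_f \<mu> \<sigma> s i b + ((1 - b') / b' - (1 - b) / b)"
      using ev by eventually_elim (use upper in auto)
  qed
qed

text \<open>Approaching \<open>b\<close> from the left brings each ratio to its limit from above,
  the side on which \<open>phi_min\<close> is continuous; the limiting denominators are
  positive.\<close>

lemma ratio_sum_left_continuous:
  assumes "0 < b" "b < 1"
  shows "(ratio_sum \<longlongrightarrow> ratio_sum b) (at_left b)"
  unfolding ratio_sum_def U_star_min_def U_min_def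
proof (intro tendsto_sum tendsto_divide)
  fix i
  assume "i \<in> {i. i \<noteq> s}"
  then have i: "i \<noteq> s" by simp
  have r: "r_f \<mu> \<sigma> s i b \<ge> 0"
    using balanced_alpha_f[OF assms] assms by (simp add: r_f_def balanced_def less_imp_le)
  have lim: "((\<lambda>b. p i (r_f \<mu> \<sigma> s i b)) \<longlongrightarrow> p i (r_f \<mu> \<sigma> s i b)) (at_left b)"
    using continuous_within_tendsto_compose[OF phi_min_right_continuous[OF i r]]
      r_f_left_limit[OF assms i] by blast
  have cont: "isCont (h j) x" for j x
    using continuous_on_log_dev[of UNIV \<mu> \<sigma> j] by (simp add: continuous_on_eq_continuous_at)
  show "((\<lambda>b. h s (p i (r_f \<mu> \<sigma> s i b))) \<longlongrightarrow> h s (p i (r_f \<mu> \<sigma> s i b))) (at_left b)"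
    "((\<lambda>b. h i (p i (r_f \<mu> \<sigma> s i b))) \<longlongrightarrow> h i (p i (r_f \<mu> \<sigma> s i b))) (at_left b)"
    using isCont_tendsto_compose[OF cont lim] by auto
  show "h i (p i (r_f \<mu> \<sigma> s i b)) \<noteq> 0"
    using h_phi_min_pos[OF i r] by simp
qed

text \<open>The sum exceeds 1 to the left of the optimal weight, and left continuity passes the weak
  inequality to the limit. Hence the maximum is attained at the optimal weight and not merely
  approached.\<close>

lemma optimal_ratio_sum_ge:
  assumes "optimal \<mu> \<sigma> s \<alpha>"
  shows "1 \<le> ratio_sum (\<alpha> $ s)"
proof (rule tendsto_lowerbound)
  note b = balanced_bounds[OF optimal_balanced[OF assms]]
  show "(ratio_sum \<longlongrightarrow> ratio_sum (\<alpha> $ s)) (at_left (\<alpha> $ s))"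
    using b by (rule ratio_sum_left_continuous)
  show "\<forall>\<^sub>F b in at_left (\<alpha> $ s). 1 \<le> ratio_sum b"
    using eventually_at_left_real[OF b(1)]
    by eventually_elim (use optimal_ratio_sum(1)[OF assms] b in \<open>auto intro!: less_imp_le\<close>)
qed simp

end

theorem theorem2:
  fixes \<mu> \<sigma> :: "real ^ ('k::finite)" and s :: 'k
  assumes "CARD('k) \<ge> 2"
    and "\<And>i. (\<sigma> $ i)\<^sup>2 > 0"
    and "{i. is_arg_max (\<lambda>j. \<mu> $ j) (\<lambda>_. True) i} = {s}"
  defines "S \<equiv> {b \<in> {0<..<1}.
      (\<Sum>i\<in>{i. i \<noteq> s}. U_star_min \<mu> \<sigma> s i (r_f \<mu> \<sigma> s i b) / U_min \<mu> \<sigma> s i (r_f \<mu> \<sigma> s i b)) \<ge> 1}"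
  shows "(\<exists>!\<alpha>. optimal \<mu> \<sigma> s \<alpha>) \<and>
    (\<forall>\<alpha>. optimal \<mu> \<sigma> s \<alpha> \<longrightarrow>
      (\<alpha> $ s \<in> S \<and> (\<forall>b\<in>S. b \<le> \<alpha> $ s)) \<and>
      (\<forall>i j. i \<noteq> s \<longrightarrow> j \<noteq> s \<longrightarrow>
        rate_fun \<mu> \<sigma> s i (\<alpha> $ i) (\<alpha> $ s) = rate_fun \<mu> \<sigma> s j (\<alpha> $ j) (\<alpha> $ s)))"
proof -
  interpret selection \<mu> \<sigma> s
  proof
    show "\<exists>j. j \<noteq> s"
    proof (rule ccontr)
      assume "\<not> (\<exists>j. j \<noteq> s)"
      then have "(UNIV :: 'k set) = {s}" by auto
      then have "CARD('k) = card {s}" by (rule arg_cong)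
      with assms(1) show False by simp
    qed
    have s_max: "\<mu> $ j \<le> \<mu> $ s" for j
      using assms(3) by (auto simp: is_arg_max_def set_eq_iff not_less)
    \<comment> \<open>An alternative not strictly below \<open>s\<close> would be a second maximiser
      of the means.\<close>
    show "\<mu> $ i < \<mu> $ s" if "i \<noteq> s" for i
    proof (rule ccontr)
      assume "\<not> \<mu> $ i < \<mu> $ s"
      then have "is_arg_max (\<lambda>j. \<mu> $ j) (\<lambda>_. True) i"
        using s_max by (auto simp: is_arg_max_def not_less intro: order_trans)
      with assms(3) that show False by blast
    qed
  qed (fact assms(2))
  have S: "S = {b \<in> {0<..<1}. ratio_sum b \<ge> 1}"
    by (simp add: S_def ratio_sum_def)
  show ?thesis
  proof (intro conjI allI impI ballI)
    show "\<exists>!\<alpha>. optimal \<mu> \<sigma> s \<alpha>"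
      using optimal_exists optimal_unique by blast
  next
    fix \<alpha>
    assume opt: "optimal \<mu> \<sigma> s \<alpha>"
    note bal = optimal_balanced[OF opt]
    show "\<alpha> $ s \<in> S"
      using balanced_bounds[OF bal] optimal_ratio_sum_ge[OF opt] by (simp add: S)
    \<comment> \<open>To the right of the optimal weight the sum of ratios is below 1.\<close>
    show "b \<le> \<alpha> $ s" if "b \<in> S" for b
      using optimal_ratio_sum(2)[OF opt, of b] that by (fastforce simp: S)
    show "rate_fun \<mu> \<sigma> s i (\<alpha> $ i) (\<alpha> $ s) = rate_fun \<mu> \<sigma> s j (\<alpha> $ j) (\<alpha> $ s)" if "i \<noteq> s" "j \<noteq> s" for i j
      using bal that unfolding balanced_def by blast
  qed
qed

end
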